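(* Let $R$ be an integral domain with unit, $p,q\in R$, $U=(U_n)$ with $U_0=0$, $U_1=1$, $U_n=pU_{n-1}-qU_{n-2}$, and $x_n=U_n/U_{n-1}$ for $n\ge2$. Let $F$ be the Fibonacci sequence ($F_0=0$, $F_1=1$, $F_n=F_{n-1}+F_{n-2}$). Then the sequence $y_n=x_{F_{n+2}+1}$, $n\ge0$, coincides with the sequence of approximations of the root of $t^2-pt+q$ produced by the secant method started from $y_0=x_2$ and $y_1=x_3$; that is, for all $n\ge2$ (whenever defined), $$x_{F_{n+2}+1}=\frac{x_{F_{n+1}+1}\,x_{F_{n}+1}-q}{x_{F_{n+1}+1}+x_{F_{n}+1}-p}.$$
   Context: The secant method for an equation $f(t)=0$ with initial approximations $y_0,y_1$ is $y_n=y_{n-1}-\dfrac{f(y_{n-1})(y_{n-1}-y_{n-2})}{f(y_{n-1})-f(y_{n-2})}$ for $n\ge2$; for $f(t)=t^2-pt+q$ this simplifies to $y_n=\dfrac{y_{n-1}y_{n-2}-q}{y_{n-1}+y_{n-2}-p}$. The paper regards these as approximations of the root of larger modulus of $t^2-pt+q$ (when it exists and is real). *)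

theory Defs
  imports "HOL-Computational_Algebra.Fraction_Field" "HOL-Number_Theory.Fib"
begin

fun lucas_U :: "'a::comm_ring_1 \<Rightarrow> 'a \<Rightarrow> nat \<Rightarrow> 'a" where
  "lucas_U p q 0 = 0"
| "lucas_U p q (Suc 0) = 1"
| "lucas_U p q (Suc (Suc n)) = p * lucas_U p q (Suc n) - q * lucas_U p q n"

text \<open>The ratios \<open>x n = U n / U (n - 1)\<close> live in the fraction field. Since \<open>Fract a 0 = 0\<close>,
  they are meaningful only under \<open>lucas_ratio_defined\<close>.\<close>

definition lucas_ratio :: "'a::idom \<Rightarrow> 'a \<Rightarrow> nat \<Rightarrow> 'a fract" where
  "lucas_ratio p q n = Fraction_Field.Fract (lucas_U p q n) (lucas_U p q (n - 1))"

definition lucas_ratio_defined :: "'a::idom \<Rightarrow> 'a \<Rightarrow> nat \<Rightarrow> bool" where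
  "lucas_ratio_defined p q n \<longleftrightarrow> n \<ge> 2 \<and> lucas_U p q (n - 1) \<noteq> 0"

definition char_fun :: "'a::idom \<Rightarrow> 'a \<Rightarrow> 'a fract \<Rightarrow> 'a fract" where
  "char_fun p q t = t ^ 2 - Fraction_Field.Fract p 1 * t + Fraction_Field.Fract q 1"

fun secant :: "('k::field \<Rightarrow> 'k) \<Rightarrow> 'k \<Rightarrow> 'k \<Rightarrow> nat \<Rightarrow> 'k" where
  "secant f a b 0 = a"
| "secant f a b (Suc 0) = b"
| "secant f a b (Suc (Suc n)) =
     secant f a b (Suc n)
       - f (secant f a b (Suc n)) * (secant f a b (Suc n) - secant f a b n)
         / (f (secant f a b (Suc n)) - f (secant f a b n))"

text \<open>Division in a field is total in HOL (\<open>x / 0 = 0\<close>); the following says that no division by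
  zero occurs in computing the iterates with index up to \<open>N\<close>.\<close>

definition secant_defined :: "('k::field \<Rightarrow> 'k) \<Rightarrow> 'k \<Rightarrow> 'k \<Rightarrow> nat \<Rightarrow> bool" where
  "secant_defined f a b N \<longleftrightarrow>
     (\<forall>n. 2 \<le> n \<and> n \<le> N \<longrightarrow> f (secant f a b (n - 1)) - f (secant f a b (n - 2)) \<noteq> 0)"

end

theory Submission
  imports Defs
begin

text \<open>The addition formulas for \<open>U\<close> express \<open>x (a + b + 1)\<close> as the secant expression in
  \<open>x (a + 1)\<close> and \<open>x (b + 1)\<close>, and \<open>fib (n + 2) = fib (n + 1) + fib n\<close> adds the indices. The
  secant step for a monic quadratic degenerates only if \<open>s = t\<close> or \<open>s + t = p\<close>. The latter means
  that the next ratio is undefined, and by d'Ocagne's identity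
  \<open>U (m + 1) * U (m + k) - U (m + k + 1) * U m = q ^ m * U k\<close> the former means that \<open>q = 0\<close> or that
  an earlier ratio is undefined.\<close>

text \<open>In \<open>m\<close>, both sides satisfy the recurrence of \<open>U\<close> and agree at
  0 and 1. It is the top left entry of \<open>M ^ m * M ^ n\<close> for the companion matrix
  \<open>M\<close> of \<open>t^2 - p t + q\<close>.\<close>

lemma lucas_U_add_Suc:
  "lucas_U p q (Suc (m + n)) = lucas_U p q (Suc m) * lucas_U p q (Suc n) - q * lucas_U p q m * lucas_U p q n"
proof (induction p q m rule: lucas_U.induct)
  case (3 p q m)
  have "lucas_U p q (Suc (Suc (Suc m) + n)) =
      p * lucas_U p q (Suc (Suc m + n)) - q * lucas_U p q (Suc (m + n))"
    by simp
  then show ?case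
    using 3 by (simp only: lucas_U.simps(3)[of p q "Suc m"] lucas_U.simps(3)[of p q m])
      (simp add: algebra_simps)
qed simp_all

text \<open>The usual formula contains \<open>q * U (n - 1)\<close>, here replaced by
  \<open>p * U n - U (n + 1)\<close>. This avoids a negative index, and dividing by
  \<open>U m * U n\<close> turns the right side into \<open>x + y - p\<close>.\<close>

lemma lucas_U_add:
  "lucas_U p q (m + n) =
     lucas_U p q (Suc m) * lucas_U p q n + lucas_U p q m * lucas_U p q (Suc n)
       - p * lucas_U p q m * lucas_U p q n"
proof (cases m)
  case (Suc k)
  then show ?thesis
    using lucas_U_add_Suc[of p q k n] by (simp add: algebra_simps)
qed simp

text \<open>Raising \<open>m\<close> by one multiplies this 2 by 2 determinant by \<open>q\<close>;
  at \<open>m = 0\<close> it is \<open>U k\<close>.\<close>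

lemma lucas_U_dOcagne:
  "lucas_U p q (Suc m) * lucas_U p q (m + k) - lucas_U p q (Suc (m + k)) * lucas_U p q m
     = q ^ m * lucas_U p q k"
proof (induction m)
  case (Suc m)
  have "lucas_U p q (Suc (Suc m)) * lucas_U p q (Suc m + k)
        - lucas_U p q (Suc (Suc m + k)) * lucas_U p q (Suc m)
      = q * (lucas_U p q (Suc m) * lucas_U p q (m + k) - lucas_U p q (Suc (m + k)) * lucas_U p q m)"
    by (simp add: algebra_simps)
  then show ?case
    using Suc.IH by simp
qed simp

text \<open>The embedding into the fraction field is a ring homomorphism, so it commutes with the
  recurrence. Ratios can then be handled by field arithmetic.\<close>

lemma Fract_lucas_U:
  "Fraction_Field.Fract (lucas_U p q n) 1 =
     lucas_U (Fraction_Field.Fract p 1) (Fraction_Field.Fract q 1) n"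
proof (induction p q n rule: lucas_U.induct)
  case (3 p q n)
  then show ?case
    by (simp flip: 3)
qed (simp_all add: Zero_fract_def One_fract_def)

text \<open>At \<open>U n = 0\<close> both sides are 0, since \<open>Fract a 0 = 0\<close> and
  \<open>x / 0 = 0\<close>.\<close>

lemma lucas_ratio_Suc:
  "lucas_ratio p q (Suc n) =
     lucas_U (Fraction_Field.Fract p 1) (Fraction_Field.Fract q 1) (Suc n) /
     lucas_U (Fraction_Field.Fract p 1) (Fraction_Field.Fract q 1) n"
  by (simp add: lucas_ratio_def flip: Fract_lucas_U)

lemma lucas_ratio_defined_Suc:
  "lucas_ratio_defined p q (Suc n) \<longleftrightarrow>
     n > 0 \<and> lucas_U (Fraction_Field.Fract p 1) (Fraction_Field.Fract q 1) n \<noteq> 0"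
  by (auto simp: lucas_ratio_defined_def Zero_fract_def eq_fract simp flip: Fract_lucas_U)

text \<open>Both addition formulas contain the nonzero factor \<open>U a * U b\<close>, which
  cancels in their quotient. If \<open>x + y = p\<close>, both sides of the second claim are 0 by
  the convention on division.\<close>

lemma
  assumes "lucas_ratio_defined p q (Suc a)" "lucas_ratio_defined p q (Suc b)"
  shows lucas_ratio_defined_add:
      "lucas_ratio_defined p q (Suc (a + b)) \<longleftrightarrow>
        lucas_ratio p q (Suc a) + lucas_ratio p q (Suc b) - Fraction_Field.Fract p 1 \<noteq> 0"
    and lucas_ratio_add:
      "lucas_ratio p q (Suc (a + b)) =
        (lucas_ratio p q (Suc a) * lucas_ratio p q (Suc b) - Fraction_Field.Fract q 1) /
        (lucas_ratio p q (Suc a) + lucas_ratio p q (Suc b) - Fraction_Field.Fract p 1)"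
proof -
  define P Q where "P = Fraction_Field.Fract p 1" and "Q = Fraction_Field.Fract q 1"
  define x y where "x = lucas_ratio p q (Suc a)" and "y = lucas_ratio p q (Suc b)"
  have nz: "lucas_U P Q a \<noteq> 0" "lucas_U P Q b \<noteq> 0" "a > 0"
    using assms by (simp_all add: lucas_ratio_defined_Suc P_def Q_def)
  have xy: "lucas_U P Q (Suc a) = x * lucas_U P Q a" "lucas_U P Q (Suc b) = y * lucas_U P Q b"
    using nz by (simp_all add: lucas_ratio_Suc x_def y_def P_def Q_def)
  have num: "lucas_U P Q (Suc (a + b)) = (lucas_U P Q a * lucas_U P Q b) * (x * y - Q)"
    unfolding lucas_U_add_Suc xy by (simp add: algebra_simps)
  have den: "lucas_U P Q (a + b) = (lucas_U P Q a * lucas_U P Q b) * (x + y - P)"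
    unfolding lucas_U_add xy by (simp add: algebra_simps)
  show "lucas_ratio_defined p q (Suc (a + b)) \<longleftrightarrow>
      lucas_ratio p q (Suc a) + lucas_ratio p q (Suc b) - Fraction_Field.Fract p 1 \<noteq> 0"
    unfolding lucas_ratio_defined_Suc P_def[symmetric] Q_def[symmetric] x_def[symmetric]
      y_def[symmetric] den using nz by simp
  have "lucas_ratio p q (Suc (a + b)) = (x * y - Q) / (x + y - P)"
    unfolding lucas_ratio_Suc P_def[symmetric] Q_def[symmetric] num den using nz by simp
  then show "lucas_ratio p q (Suc (a + b)) =
      (lucas_ratio p q (Suc a) * lucas_ratio p q (Suc b) - Fraction_Field.Fract q 1) /
      (lucas_ratio p q (Suc a) + lucas_ratio p q (Suc b) - Fraction_Field.Fract p 1)"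
    by (simp add: x_def y_def P_def Q_def)
qed

text \<open>Equal ratios, cross-multiplied, make d'Ocagne's determinant vanish, yet
  \<open>q ^ m * U k\<close> is nonzero. In the application \<open>m\<close> and \<open>k\<close>
  are consecutive Fibonacci numbers, so the ratio at \<open>k\<close> is an earlier one.\<close>

lemma lucas_ratio_neq:
  assumes "q \<noteq> 0" "lucas_ratio_defined p q (Suc m)" "lucas_ratio_defined p q (Suc k)"
    and "lucas_ratio_defined p q (Suc (m + k))"
  shows "lucas_ratio p q (Suc (m + k)) \<noteq> lucas_ratio p q (Suc m)"
proof
  define P Q where "P = Fraction_Field.Fract p 1" and "Q = Fraction_Field.Fract q 1"
  have Q: "Q \<noteq> 0"
    using assms(1) by (simp add: Q_def Zero_fract_def eq_fract)
  have nz: "lucas_U P Q m \<noteq> 0" "lucas_U P Q k \<noteq> 0" "lucas_U P Q (m + k) \<noteq> 0"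
    using assms by (simp_all add: lucas_ratio_defined_Suc P_def Q_def)
  assume "lucas_ratio p q (Suc (m + k)) = lucas_ratio p q (Suc m)"
  then have "lucas_U P Q (Suc (m + k)) * lucas_U P Q m = lucas_U P Q (Suc m) * lucas_U P Q (m + k)"
    unfolding lucas_ratio_Suc P_def[symmetric] Q_def[symmetric]
    using nz by (simp add: frac_eq_eq)
  then have "Q ^ m * lucas_U P Q k = 0"
    using lucas_U_dOcagne[of P Q m k] by simp
  then show False
    using Q nz by simp
qed

lemma char_fun_diff:
  "char_fun p q s - char_fun p q t = (s - t) * (s + t - Fraction_Field.Fract p 1)"
  by (simp add: char_fun_def power2_eq_square algebra_simps)

text \<open>Cancelling \<open>s - t\<close> leaves the denominator \<open>s + t - p\<close>. The
  hypothesis also excludes \<open>s = t\<close>, where the left side collapses to \<open>s\<close>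
  while the right side is the Newton step.\<close>

lemma secant_step_char_fun:
  assumes "char_fun p q s - char_fun p q t \<noteq> 0"
  shows "s - char_fun p q s * (s - t) / (char_fun p q s - char_fun p q t) =
    (s * t - Fraction_Field.Fract q 1) / (s + t - Fraction_Field.Fract p 1)"
proof -
  have nz: "s - t \<noteq> 0" "s + t - Fraction_Field.Fract p 1 \<noteq> 0"
    using assms by (auto simp: char_fun_diff)
  have "s - char_fun p q s * (s - t) / (char_fun p q s - char_fun p q t) =
      s - char_fun p q s / (s + t - Fraction_Field.Fract p 1)"
    using nz(1) by (simp add: char_fun_diff)
  also have "\<dots> = (s * (s + t - Fraction_Field.Fract p 1) - char_fun p q s) /
      (s + t - Fraction_Field.Fract p 1)"
    using nz(2) by (simp add: diff_divide_distrib)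
  also have "s * (s + t - Fraction_Field.Fract p 1) - char_fun p q s =
      s * t - Fraction_Field.Fract q 1"
    by (simp add: char_fun_def power2_eq_square algebra_simps flip: Zero_fract_def)
  finally show ?thesis .
qed

lemma lucas_ratio_defined_2: "lucas_ratio_defined p q 2"
  by (simp add: lucas_ratio_defined_def)

text \<open>The offset 2 matches the starting values: \<open>fib 2 = 1\<close> and
  \<open>fib 3 = 2\<close> give the ratios at 2 and 3. Definedness is part of the induction because
  the addition formula requires it of both earlier ratios.\<close>

lemma secant_eq_lucas_ratio:
  assumes "lucas_ratio_defined p q 3"
    and "secant_defined (char_fun p q) (lucas_ratio p q 2) (lucas_ratio p q 3) N"
    and "n \<le> N"
  shows "lucas_ratio_defined p q (Suc (fib (n + 2))) \<and>
    lucas_ratio p q (Suc (fib (n + 2))) =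
      secant (char_fun p q) (lucas_ratio p q 2) (lucas_ratio p q 3) n"
  using assms(3)
proof (induction n rule: less_induct)
  case (less n)
  consider "n = 0" | "n = 1" | m where "n = Suc (Suc m)"
    by (metis One_nat_def not0_implies_Suc)
  then show ?case
  proof cases
    case 1
    then show ?thesis
      using lucas_ratio_defined_2[of p q] by (simp add: numeral_2_eq_2)
  next
    case 2
    then show ?thesis
      using assms(1) by (simp add: numeral_3_eq_3)
  next
    case 3
    define S where "S = secant (char_fun p q) (lucas_ratio p q 2) (lucas_ratio p q 3)"
    define a b where "a = fib (m + 3)" and "b = fib (m + 2)"
    have ab: "fib (n + 2) = a + b"
      using 3 by (simp add: a_def b_def numeral_3_eq_3)
    have a: "lucas_ratio_defined p q (Suc a)" "lucas_ratio p q (Suc a) = S (Suc m)"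
      using less.IH[of "Suc m"] less.prems 3 by (simp_all add: a_def S_def numeral_3_eq_3)
    have b: "lucas_ratio_defined p q (Suc b)" "lucas_ratio p q (Suc b) = S m"
      using less.IH[of m] less.prems 3 by (simp_all add: b_def S_def)
    have nz: "char_fun p q (S (Suc m)) - char_fun p q (S m) \<noteq> 0"
      using assms(2)[unfolded secant_defined_def, rule_format, of n] less.prems 3
      by (simp add: S_def del: secant.simps)
    \<comment> \<open>A nonzero secant denominator has a nonzero factor \<open>s + t - p\<close>,
      which is definedness of the next ratio.\<close>
    have ab_defined: "lucas_ratio_defined p q (Suc (a + b))"
      using nz by (simp add: lucas_ratio_defined_add a b char_fun_diff)
    have "S n = (S (Suc m) * S m - Fraction_Field.Fract q 1) /
        (S (Suc m) + S m - Fraction_Field.Fract p 1)"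
      using secant_step_char_fun[OF nz] 3 by (simp add: S_def)
    then show ?thesis
      using lucas_ratio_add[OF a(1) b(1)] ab_defined
      unfolding ab a(2) b(2) S_def by simp
  qed
qed

text \<open>The case \<open>q = 0\<close>, \<open>p \<noteq> 0\<close> must be excluded: there
  \<open>U n = p ^ (n - 1)\<close> for positive \<open>n\<close>, every ratio is \<open>p\<close>,
  and the first secant step divides by zero.\<close>

lemma secant_defined_if_lucas_ratio_defined:
  assumes "q \<noteq> 0" and "\<forall>n\<le>N. lucas_ratio_defined p q (Suc (fib (n + 2)))"
  shows "secant_defined (char_fun p q) (lucas_ratio p q 2) (lucas_ratio p q 3) N"
  using assms(2)
proof (induction N)
  case 0
  then show ?case
    by (simp add: secant_defined_def)
next
  case (Suc N)
  define S where "S = secant (char_fun p q) (lucas_ratio p q 2) (lucas_ratio p q 3)"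
  have IH: "secant_defined (char_fun p q) (lucas_ratio p q 2) (lucas_ratio p q 3) N"
    using Suc by simp
  \<comment> \<open>This is the only new denominator, that of iterate \<open>Suc N\<close>; it
    occurs only when \<open>Suc N\<close> is at least 2.\<close>
  have "char_fun p q (S N) - char_fun p q (S (N - 1)) \<noteq> 0" if N: "N > 0"
  proof -
    obtain m where m: "N = Suc m"
      using gr0_implies_Suc[OF N] by blast
    define a b where "a = fib (m + 3)" and "b = fib (m + 2)"
    have a_eq: "a = b + fib (Suc m)"
      by (simp add: a_def b_def numeral_3_eq_3)
    have def3: "lucas_ratio_defined p q 3"
      using Suc.prems[rule_format, of 1] by (simp add: numeral_3_eq_3)
    have a: "lucas_ratio_defined p q (Suc a)" "lucas_ratio p q (Suc a) = S (Suc m)"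
      using secant_eq_lucas_ratio[OF def3 IH, of "Suc m"] m
      by (simp_all add: a_def S_def numeral_3_eq_3)
    have b: "lucas_ratio_defined p q (Suc b)" "lucas_ratio p q (Suc b) = S m"
      using secant_eq_lucas_ratio[OF def3 IH, of m] m by (simp_all add: b_def S_def)
    \<comment> \<open>The shift \<open>a - b\<close> is \<open>fib (m + 1)\<close>. For
      \<open>m = 0\<close> it is \<open>fib 1\<close>, which lies below the range
      \<open>fib (n + 2)\<close> of the hypothesis but yields the ratio at 2.\<close>
    have "lucas_ratio_defined p q (Suc (fib (Suc m)))"
    proof (cases m)
      case 0
      then show ?thesis
        using lucas_ratio_defined_2[of p q] by (simp add: numeral_2_eq_2)
    next
      case (Suc k)
      then show ?thesis
        using Suc.prems[rule_format, of k] m by simp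
    qed
    then have "S (Suc m) \<noteq> S m"
      using lucas_ratio_neq[OF assms(1) b(1), of "fib (Suc m)"] a b by (simp flip: a_eq)
    moreover have "lucas_ratio_defined p q (Suc (a + b))"
      using Suc.prems[rule_format, of "Suc N"] m by (simp add: a_def b_def numeral_3_eq_3)
    then have "S (Suc m) + S m - Fraction_Field.Fract p 1 \<noteq> 0"
      using lucas_ratio_defined_add[OF a(1) b(1)] a b by simp
    ultimately show ?thesis
      by (simp add: char_fun_diff m)
  qed
  then show ?case
    using IH by (auto simp: secant_defined_def S_def le_Suc_eq)
qed

text \<open>"Whenever defined" may refer to the secant iterates or to the ratios; the first two
  parts pass between these readings. The third treats the simplified recursion, whose denominator
  lacks the factor \<open>s - t\<close>, and so covers \<open>q = 0\<close> as well.\<close>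

theorem theorem3p1:
  fixes p q :: "'a::idom"
  shows "(\<forall>N. lucas_ratio_defined p q 3 \<and>
              secant_defined (char_fun p q) (lucas_ratio p q 2) (lucas_ratio p q 3) N \<longrightarrow>
              (\<forall>n\<le>N. lucas_ratio_defined p q (fib (n + 2) + 1) \<and>
                      lucas_ratio p q (fib (n + 2) + 1) =
                        secant (char_fun p q) (lucas_ratio p q 2) (lucas_ratio p q 3) n))
       \<and> (\<forall>N. q \<noteq> 0 \<and> (\<forall>n\<le>N. lucas_ratio_defined p q (fib (n + 2) + 1)) \<longrightarrow>
              secant_defined (char_fun p q) (lucas_ratio p q 2) (lucas_ratio p q 3) N)
       \<and> (\<forall>n\<ge>2. lucas_ratio_defined p q (fib (n + 1) + 1) \<and>
                 lucas_ratio_defined p q (fib n + 1) \<longrightarrow>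
              (lucas_ratio_defined p q (fib (n + 2) + 1) \<longleftrightarrow>
                 lucas_ratio p q (fib (n + 1) + 1) + lucas_ratio p q (fib n + 1) - Fraction_Field.Fract p 1 \<noteq> 0) \<and>
              (lucas_ratio_defined p q (fib (n + 2) + 1) \<longrightarrow>
                 lucas_ratio p q (fib (n + 2) + 1) =
                   (lucas_ratio p q (fib (n + 1) + 1) * lucas_ratio p q (fib n + 1) - Fraction_Field.Fract q 1) /
                   (lucas_ratio p q (fib (n + 1) + 1) + lucas_ratio p q (fib n + 1) - Fraction_Field.Fract p 1)))"
proof (intro conjI allI impI)
  fix n :: nat
  assume "2 \<le> n"
    and "lucas_ratio_defined p q (fib (n + 1) + 1) \<and> lucas_ratio_defined p q (fib n + 1)"
  then have ab: "lucas_ratio_defined p q (Suc (fib (n + 1)))" "lucas_ratio_defined p q (Suc (fib n))"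
    by simp_all
  have fib: "fib (n + 2) = fib (n + 1) + fib n"
    by simp
  show "lucas_ratio_defined p q (fib (n + 2) + 1) \<longleftrightarrow>
      lucas_ratio p q (fib (n + 1) + 1) + lucas_ratio p q (fib n + 1) - Fraction_Field.Fract p 1 \<noteq> 0"
    using lucas_ratio_defined_add[OF ab] unfolding fib by simp
  assume "lucas_ratio_defined p q (fib (n + 2) + 1)"
  then show "lucas_ratio p q (fib (n + 2) + 1) =
      (lucas_ratio p q (fib (n + 1) + 1) * lucas_ratio p q (fib n + 1) - Fraction_Field.Fract q 1) /
      (lucas_ratio p q (fib (n + 1) + 1) + lucas_ratio p q (fib n + 1) - Fraction_Field.Fract p 1)"
    using lucas_ratio_add[OF ab] unfolding fib by simp
qed (use secant_eq_lucas_ratio[of p q] secant_defined_if_lucas_ratio_defined[of q _ p]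
  in \<open>unfold Suc_eq_plus1, blast+\<close>)

end
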